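(* Let $G$ be a connected infinite graph of bounded degree with edge-Cheeger constant $h_E(G)>0$, let $o\in V(G)$, and consider Bernoulli bond percolation on $G$. Then $p_{\mathbb{C}}\le \dfrac{1}{1+h_E(G)}$.
   Context: In Bernoulli bond percolation with parameter $p$ each edge of $G$ is independently occupied with probability $p$ and vacant otherwise; $\Pr_p$ is the law. $C(o)$ is the connected component of $o$ in the subgraph of occupied edges, and $\theta_o(p):=\Pr_p(|C(o)|=\infty)$. The edge-Cheeger constant is $h_E(G):=\inf_S \frac{|\partial_E S|}{|S|}$, where $S$ ranges over all finite non-empty subgraphs of $G$, $|S|$ is the number of vertices of $S$, and $\partial_E S$ is the set of edges in $E(G)\setminus E(S)$ that are incident with $S$. $p_{\mathbb{C}}:=\inf\{p\le 1 : \theta_o \text{ is analytic in } (p,1]\}$. A function $f$ is analytic on an interval $I\subset\mathbb{R}$ if every $x\in I$ is the centre of an open disc $D\subset\mathbb{C}$ on which there is a holomorphic function agreeing with $f$ on $D\cap I$. *)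

theory Defs
  imports "HOL-Probability.Probability" "HOL-Complex_Analysis.Complex_Analysis"
begin

text \<open>A (possibly infinite) simple graph is given by its vertex set \<open>V\<close> and its set \<open>E\<close> of
  edges, each edge being the two-element set of its endvertices.\<close>

definition graph :: "'a set \<Rightarrow> 'a set set \<Rightarrow> bool" where
  "graph V E \<longleftrightarrow> (\<forall>e\<in>E. e \<subseteq> V \<and> card e = 2)"

definition subgraph :: "'a set \<Rightarrow> 'a set set \<Rightarrow> 'a set \<Rightarrow> 'a set set \<Rightarrow> bool" where
  "subgraph W F V E \<longleftrightarrow> graph W F \<and> W \<subseteq> V \<and> F \<subseteq> E"

text \<open>Vertex set of the connected component of \<open>v\<close>, for \<open>v\<close> a vertex of the graph.\<close>

definition component :: "'a set set \<Rightarrow> 'a \<Rightarrow> 'a set" where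
  "component E v = {w. (v, w) \<in> {(x, y). {x, y} \<in> E}\<^sup>*}"

definition connected_graph :: "'a set \<Rightarrow> 'a set set \<Rightarrow> bool" where
  "connected_graph V E \<longleftrightarrow> (\<forall>v\<in>V. \<forall>w\<in>V. w \<in> component E v)"

definition bounded_degree :: "'a set \<Rightarrow> 'a set set \<Rightarrow> bool" where
  "bounded_degree V E \<longleftrightarrow> (\<exists>d. \<forall>v\<in>V. finite {e\<in>E. v \<in> e} \<and> card {e\<in>E. v \<in> e} \<le> d)"

definition edge_boundary :: "'a set set \<Rightarrow> 'a set \<Rightarrow> 'a set set \<Rightarrow> 'a set set" where
  "edge_boundary E W F = {e \<in> E - F. e \<inter> W \<noteq> {}}"

text \<open>Subgraphs need not be induced. In a graph of bounded degree all the edge boundaries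
  below are finite, so \<open>card\<close> is their true size.\<close>

definition edge_cheeger :: "'a set \<Rightarrow> 'a set set \<Rightarrow> real" where
  "edge_cheeger V E =
     Inf {real (card (edge_boundary E W F)) / real (card W) | W F.
            subgraph W F V E \<and> finite W \<and> W \<noteq> {}}"

text \<open>A percolation configuration \<open>\<omega>\<close> maps an edge to \<open>True\<close> iff it is occupied. Only
  \<open>p \<in> {0..1}\<close> is meaningful, as \<open>bernoulli_pmf\<close> truncates other values to this interval.\<close>

definition percolation :: "'a set set \<Rightarrow> real \<Rightarrow> ('a set \<Rightarrow> bool) measure" where
  "percolation E p = Pi\<^sub>M E (\<lambda>_. measure_pmf (bernoulli_pmf p))"

definition cluster :: "'a set set \<Rightarrow> ('a set \<Rightarrow> bool) \<Rightarrow> 'a \<Rightarrow> 'a set" where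
  "cluster E \<omega> v = component {e\<in>E. \<omega> e} v"

definition perc_prob :: "'a set set \<Rightarrow> 'a \<Rightarrow> real \<Rightarrow> real" where
  "perc_prob E v p =
     measure (percolation E p) {\<omega> \<in> space (percolation E p). infinite (cluster E \<omega> v)}"

definition analytic_on_interval :: "(real \<Rightarrow> real) \<Rightarrow> real set \<Rightarrow> bool" where
  "analytic_on_interval f I \<longleftrightarrow>
     (\<forall>x\<in>I. \<exists>r>0. \<exists>g. g holomorphic_on ball (complex_of_real x) r \<and>
        (\<forall>y\<in>I. complex_of_real y \<in> ball (complex_of_real x) r \<longrightarrow>
           g (complex_of_real y) = complex_of_real (f y)))"

definition p_analytic :: "'a set set \<Rightarrow> 'a \<Rightarrow> real" where
  "p_analytic E v = Inf {p. 0 \<le> p \<and> p \<le> 1 \<and> analytic_on_interval (perc_prob E v) {p<..1}}"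

end

theory Submission
  imports Defs
begin

text \<open>Sum \<open>1 - \<theta>(p)\<close> over the finite vertex sets \<open>W\<close> of the cluster of \<open>v\<close>. Exploring the
  cluster by querying only edges that leave the set reached so far shows that the probability of
  \<open>W\<close> is a positive combination of terms \<open>p\<^sup>a (1 - p)\<^sup>b\<close> with \<open>a = |W| - 1\<close> and
  \<open>b \<ge> |\<partial>W| \<ge> h |W|\<close>, where \<open>\<partial>W\<close> consists of the edges with exactly one end in \<open>W\<close>. Since
  \<open>p (1 - p)\<^sup>h\<close> decreases for \<open>p > 1 / (1 + h)\<close>, at complex parameters near such a \<open>p\<close> each
  of these polynomials is bounded by its value at a fixed real \<open>q\<close> slightly below \<open>p\<close>. The values
  at \<open>q\<close> are probabilities of disjoint events, so the series converges uniformly near \<open>p\<close>.\<close>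

section \<open>Reachable sets and components\<close>

abbreviation reach :: "'a set set \<Rightarrow> 'a set \<Rightarrow> 'a set" where
  "reach A R \<equiv> {(x, y). {x, y} \<in> A}\<^sup>* `` R"

lemma component_eq_reach: "component A v = reach A {v}"
  by (auto simp: component_def)

lemma reach_closed: "x \<in> reach A R \<Longrightarrow> {x, y} \<in> A \<Longrightarrow> y \<in> reach A R"
  by (auto intro: rtrancl_into_rtrancl)

lemma reach_subsetI:
  assumes "R \<subseteq> X" and "\<And>x y. x \<in> X \<Longrightarrow> {x, y} \<in> A \<Longrightarrow> y \<in> X"
  shows "reach A R \<subseteq> X"
proof -
  have "reach A X = X"
    by (rule Image_closed_trancl) (use assms(2) in auto)
  then show ?thesis
    using assms(1) by blast
qed

lemma subset_reach: "R \<subseteq> reach A R"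
  by auto

text \<open>Since \<open>u\<close> is already reached, the occupied edge has no effect beyond
  reaching \<open>w\<close>: any path through it can be restarted at \<open>u\<close> or at
  \<open>w\<close>. This is the exploration step for an occupied edge.\<close>

lemma reach_insert:
  assumes "u \<in> R"
  shows "reach (insert {u, w} A) R = reach A (insert w R)"
proof
  show "reach (insert {u, w} A) R \<subseteq> reach A (insert w R)"
  proof (rule reach_subsetI)
    fix x y assume x: "x \<in> reach A (insert w R)" and xy: "{x, y} \<in> insert {u, w} A"
    show "y \<in> reach A (insert w R)"
    proof (cases "{x, y} \<in> A")
      case True
      then show ?thesis using x by (rule reach_closed[rotated])
    next
      case False
      then have "y \<in> insert w R"
        using xy assms by (auto simp: doubleton_eq_iff)
      then show ?thesis using subset_reach by blast
    qed
  qed (use subset_reach[of "insert w R" A] in blast)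
  have "u \<in> reach (insert {u, w} A) R"
    using assms subset_reach by blast
  then have "w \<in> reach (insert {u, w} A) R"
    by (rule reach_closed) simp
  then show "reach A (insert w R) \<subseteq> reach (insert {u, w} A) R"
    by (intro reach_subsetI)
       (use subset_reach[of R] in \<open>blast intro: reach_closed\<close>)+
qed

text \<open>A component equal to \<open>W\<close> is traced out by edges meeting \<open>W\<close>,
  and an edge of \<open>A\<close> leaving \<open>W\<close> would meet \<open>W\<close> too and so be
  kept. Thus the event that the cluster is \<open>W\<close> depends only on the edges meeting
  \<open>W\<close>, which are finitely many in the application.\<close>

lemma component_restrict:
  "component A v = W \<longleftrightarrow> component {e \<in> A. e \<inter> W \<noteq> {}} v = W"
proof -
  let ?B = "{e \<in> A. e \<inter> W \<noteq> {}}"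
  have mono: "reach ?B {v} \<subseteq> reach A {v}"
    by (intro Image_mono rtrancl_mono) auto
  have 1: "reach A {v} \<subseteq> reach ?B {v}" if "reach A {v} = W"
  proof (rule reach_subsetI)
    fix x y assume "x \<in> reach ?B {v}" "{x, y} \<in> A"
    moreover from this have "x \<in> W" using mono that by blast
    ultimately show "y \<in> reach ?B {v}" using reach_closed[of x ?B "{v}" y] by auto
  qed (use subset_reach in blast)
  have 2: "reach A {v} \<subseteq> W" if "reach ?B {v} = W"
  proof (rule reach_subsetI)
    fix x y assume "x \<in> W" "{x, y} \<in> A"
    then have "{x, y} \<in> ?B" by auto
    with \<open>x \<in> W\<close> show "y \<in> W"
      using reach_closed[of x ?B "{v}" y, unfolded that] \<open>{x, y} \<in> ?B\<close> by blast
  qed (use subset_reach[of "{v}" ?B] that in blast)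
  show ?thesis
    unfolding component_eq_reach using mono 1 2 by blast
qed

section \<open>Exploration polynomials\<close>

text \<open>For \<open>p \<in> {0..1}\<close> this is the probability that the occupied edges among the finite set
  \<open>H\<close> join \<open>R\<close> to exactly the vertices of \<open>W\<close>.\<close>

definition reach_poly :: "'a set set \<Rightarrow> 'a set \<Rightarrow> 'a set \<Rightarrow> 'b::comm_ring_1 \<Rightarrow> 'b" where
  "reach_poly H R W z =
     (\<Sum>A\<in>Pow H. of_bool (reach A R = W) * (z ^ card A * (1 - z) ^ card (H - A)))"

lemma sum_Pow_insert:
  assumes "finite H" "e \<notin> H"
  shows "(\<Sum>A\<in>Pow (insert e H). g A) = (\<Sum>A\<in>Pow H. g (insert e A)) + (\<Sum>A\<in>Pow H. g A)"
proof -
  have "inj_on (insert e) (Pow H)"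
    using assms(2) by (auto simp: inj_on_def)
  then have "sum g (insert e ` Pow H) = (\<Sum>A\<in>Pow H. g (insert e A))"
    by (simp add: sum.reindex)
  moreover have "sum g (Pow H \<union> insert e ` Pow H) = sum g (Pow H) + sum g (insert e ` Pow H)"
    using assms by (intro sum.union_disjoint) auto
  ultimately show ?thesis
    by (simp add: Pow_insert add.commute)
qed

text \<open>Conditioning on the state of one edge at \<open>R\<close>: if occupied, it adds
  \<open>w\<close> to the explored set; if vacant, it is discarded. As a polynomial identity this
  holds at complex \<open>z\<close> as well.\<close>

lemma reach_poly_insert:
  assumes "finite H" "{u, w} \<notin> H" "u \<in> R"
  shows "reach_poly (insert {u, w} H) R W z =
    z * reach_poly H (insert w R) W z + (1 - z) * reach_poly H R W z"
proof -
  have "(\<Sum>A\<in>Pow H. of_bool (reach (insert {u, w} A) R = W) *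
          (z ^ card (insert {u, w} A) * (1 - z) ^ card (insert {u, w} H - insert {u, w} A)))
        = z * reach_poly H (insert w R) W z"
    unfolding reach_poly_def sum_distrib_left
  proof (rule sum.cong[OF refl])
    fix A assume "A \<in> Pow H"
    with assms have "finite A" "{u, w} \<notin> A" by (auto intro: finite_subset)
    moreover have "insert {u, w} H - insert {u, w} A = H - A" using assms(2) by auto
    ultimately show "of_bool (reach (insert {u, w} A) R = W) *
        (z ^ card (insert {u, w} A) * (1 - z) ^ card (insert {u, w} H - insert {u, w} A)) =
      z * (of_bool (reach A (insert w R) = W) * (z ^ card A * (1 - z) ^ card (H - A)))"
      unfolding reach_insert[OF assms(3)] by (simp add: mult_ac)
  qed
  moreover have "(\<Sum>A\<in>Pow H. of_bool (reach A R = W) *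
          (z ^ card A * (1 - z) ^ card (insert {u, w} H - A))) = (1 - z) * reach_poly H R W z"
    unfolding reach_poly_def sum_distrib_left
  proof (rule sum.cong[OF refl])
    fix A assume "A \<in> Pow H"
    with assms have "insert {u, w} H - A = insert {u, w} (H - A)" "{u, w} \<notin> H - A" by auto
    then show "of_bool (reach A R = W) * (z ^ card A * (1 - z) ^ card (insert {u, w} H - A)) =
      (1 - z) * (of_bool (reach A R = W) * (z ^ card A * (1 - z) ^ card (H - A)))"
      using assms(1) by (simp add: mult_ac)
  qed
  ultimately show ?thesis
    by (simp only: reach_poly_def[of "insert {u, w} H"] sum_Pow_insert[OF assms(1,2)])
qed

text \<open>The exploration has stopped: no subset of \<open>H\<close> enlarges \<open>R\<close>,
  and the weights of all subsets sum to 1 by expanding the product of the factors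
  \<open>z + (1 - z)\<close>.\<close>

lemma reach_poly_isolated:
  assumes "finite H" "\<And>e. e \<in> H \<Longrightarrow> e \<inter> R = {}"
  shows "reach_poly H R W z = of_bool (R = W)"
proof -
  have "reach A R = R" if "A \<in> Pow H" for A
    by (rule Image_closed_trancl) (use assms(2) that in fastforce)
  then have "reach_poly H R W z =
      of_bool (R = W) * (\<Sum>A\<in>Pow H. (\<Prod>e\<in>A. z) * (\<Prod>e\<in>H - A. 1 - z))"
    by (simp add: reach_poly_def sum_distrib_left)
  also have "(\<Sum>A\<in>Pow H. (\<Prod>e\<in>A. z) * (\<Prod>e\<in>H - A. 1 - z)) = (\<Prod>e\<in>H. z + (1 - z))"
    using prod_add[OF assms(1), of "\<lambda>_. z" "\<lambda>_. 1 - z"] by simp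
  finally show ?thesis by simp
qed

lemma reach_poly_eq_0:
  assumes "\<not> R \<subseteq> W"
  shows "reach_poly H R W z = 0"
  unfolding reach_poly_def
  by (rule sum.neutral) (use assms subset_reach in fastforce)

lemma of_real_reach_poly:
  "of_real (reach_poly H R W p) = (reach_poly H R W (of_real p) :: 'b::{real_algebra_1,comm_ring_1})"
  by (auto simp: reach_poly_def of_bool_def intro!: sum.cong)

lemma reach_poly_nonneg:
  fixes p :: real
  assumes "0 \<le> p" "p \<le> 1"
  shows "0 \<le> reach_poly H R W p"
  unfolding reach_poly_def using assms by (intro sum_nonneg) auto

section \<open>Comparison of complex and real parameters\<close>

text \<open>Induction on the number of unqueried edges, always querying an edge that touches
  \<open>R\<close>. Each vertex of \<open>W - R\<close> is gained by exactly one occupied query, at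
  the cost of a factor \<open>s\<close>; each edge of \<open>H\<close> leaving \<open>W\<close> must
  be queried and found vacant, giving a factor \<open>t\<close>. The remaining vacant queries cost
  at most 1. The exponent of \<open>s\<close> has to be exact because \<open>s\<close> may exceed
  1.\<close>

lemma norm_reach_poly_le:
  fixes z :: complex and q s t :: real
  assumes "finite H" "\<And>e. e \<in> H \<Longrightarrow> card e = 2" "finite W"
    and st: "0 \<le> s" "0 \<le> t" "norm z \<le> s * q" "norm (1 - z) \<le> t * (1 - q)"
    and "t \<le> 1"
    and q: "0 \<le> q" "q \<le> 1"
  shows "norm (reach_poly H R W z) \<le>
    s ^ card (W - R) * t ^ card {e \<in> H. e \<inter> W \<noteq> {} \<and> \<not> e \<subseteq> W} * reach_poly H R W q"
  using assms(1,2)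
proof (induction "card H" arbitrary: H R)
  case 0
  then have "H = {}" by simp
  then show ?case
    using reach_poly_isolated[of "{}" R W z] reach_poly_isolated[of "{}" R W q] by auto
next
  case (Suc n)
  let ?\<beta> = "\<lambda>H. {e \<in> H. e \<inter> W \<noteq> {} \<and> \<not> e \<subseteq> W}"
  consider "\<not> R \<subseteq> W" | "R \<subseteq> W" "\<And>e. e \<in> H \<Longrightarrow> e \<inter> R = {}"
    | e where "R \<subseteq> W" "e \<in> H" "e \<inter> R \<noteq> {}" by blast
  then show ?case
  proof cases
    case 1
    then show ?thesis by (simp add: reach_poly_eq_0)
  next
    case 2
    \<comment> \<open>Polymorphic, as is \<open>rec\<close> below, so that it applies both at the
      complex \<open>z\<close> and at the real \<open>q\<close>.\<close>
    have rp: "reach_poly H R W x = of_bool (R = W)" for x :: "'b::comm_ring_1"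
      using Suc.prems(1) 2(2) by (rule reach_poly_isolated)
    show ?thesis
    proof (cases "R = W")
      case True
      then have "?\<beta> H = {}" using 2(2) by blast
      then have "card (?\<beta> H) = 0" by (simp only: card.empty)
      with True show ?thesis unfolding rp by simp
    next
      case False
      then show ?thesis by (simp add: rp)
    qed
  next
    case 3
    from 3(3) obtain u where u: "u \<in> e" "u \<in> R" by blast
    have "card e = 2" using Suc.prems(2) 3(2) .
    then obtain w where e: "e = {u, w}" "u \<noteq> w"
      using u(1) by (auto simp: card_2_iff insert_commute)
    define H' where "H' = H - {e}"
    have H': "H = insert {u, w} H'" "{u, w} \<notin> H'" "finite H'" "n = card H'"
      "\<And>e. e \<in> H' \<Longrightarrow> card e = 2"
      using 3(2) Suc.prems Suc.hyps(2) by (auto simp: H'_def e(1))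
    have rec: "reach_poly H R W x = x * reach_poly H' (insert w R) W x +
        (1 - x) * reach_poly H' R W x" for x :: "'b::comm_ring_1"
      unfolding H'(1) by (rule reach_poly_insert) (use H' u in auto)
    let ?f = "\<lambda>R. reach_poly H' R W"
    have IH: "norm (?f S z) \<le> s ^ card (W - S) * t ^ card (?\<beta> H') * ?f S q" for S
      using Suc.hyps(1)[OF H'(4,3,5)] by blast
    consider "w \<in> R" | "w \<in> W" "w \<notin> R" | "w \<notin> W" by blast
    then show ?thesis
    proof cases
      case 1
      \<comment> \<open>An edge inside \<open>R\<close> has no influence: both branches coincide and
        their weights add up to 1, so it contributes no factor.\<close>
      then have "?\<beta> H = ?\<beta> H'"
        using 3(1) u by (auto simp: H'(1))
      moreover have f: "reach_poly H R W x = ?f R x" for x :: "'b::comm_ring_1"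
        using 1 rec[of x] by (simp add: insert_absorb algebra_simps)
      ultimately show ?thesis using IH unfolding f by simp
    next
      case 2
      then have \<beta>: "?\<beta> H = ?\<beta> H'"
        using 3(1) u by (auto simp: H'(1))
      have "W - R = insert w (W - insert w R)"
        using 2 by blast
      then have m: "card (W - R) = Suc (card (W - insert w R))"
        using \<open>finite W\<close> by (metis Diff_iff card_insert_disjoint finite_Diff insertI1)
      \<comment> \<open>A vacant edge inside \<open>W\<close> is not counted in the exponent of
        \<open>t\<close>, so its factor \<open>t\<close> is given up here.\<close>
      have "norm (1 - z) \<le> 1 - q"
        using st(4) mult_right_mono[OF \<open>t \<le> 1\<close>, of "1 - q"] q by simp
      have "norm (reach_poly H R W z) \<le>
          norm z * norm (?f (insert w R) z) + norm (1 - z) * norm (?f R z)"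
        unfolding rec by (metis norm_mult norm_triangle_ineq)
      also have "\<dots> \<le> s * q * (s ^ card (W - insert w R) * t ^ card (?\<beta> H') * ?f (insert w R) q)
          + (1 - q) * (s ^ card (W - R) * t ^ card (?\<beta> H') * ?f R q)"
        using st q \<open>norm (1 - z) \<le> 1 - q\<close> IH by (intro add_mono mult_mono) auto
      also have "\<dots> = s ^ card (W - R) * t ^ card (?\<beta> H) * reach_poly H R W q"
        unfolding rec \<beta> m by (simp add: algebra_simps)
      finally show ?thesis .
    next
      case 3
      \<comment> \<open>The edge leaves \<open>W\<close>, so the occupied branch vanishes and the
        vacant one supplies the factor \<open>t\<close>.\<close>
      then have "?\<beta> H = insert {u, w} (?\<beta> H')"
        using \<open>R \<subseteq> W\<close> u by (auto simp: H'(1))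
      then have b: "card (?\<beta> H) = Suc (card (?\<beta> H'))"
        using H'(2,3) by simp
      have f: "reach_poly H R W x = (1 - x) * ?f R x" for x :: "'b::comm_ring_1"
        using 3 by (simp add: rec reach_poly_eq_0)
      have "norm (reach_poly H R W z) = norm (1 - z) * norm (?f R z)"
        by (simp add: f norm_mult)
      also have "\<dots> \<le> t * (1 - q) * (s ^ card (W - R) * t ^ card (?\<beta> H') * ?f R q)"
        using st q IH by (intro mult_mono) auto
      also have "\<dots> = s ^ card (W - R) * t ^ card (?\<beta> H) * reach_poly H R W q"
        unfolding f b by simp
      finally show ?thesis .
    qed
  qed
qed

section \<open>The law of a finite cluster\<close>

lemma space_percolation: "space (percolation E p) = PiE E (\<lambda>_. UNIV)"
  by (simp add: percolation_def space_PiM)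

lemma prob_space_percolation: "prob_space (percolation E p)"
  unfolding percolation_def by (intro prob_space_PiM prob_space_measure_pmf)

lemma sets_percolation_pattern:
  assumes "finite H" "H \<subseteq> E"
  shows "{\<omega> \<in> space (percolation E p). {e \<in> H. \<omega> e} = A} \<in> sets (percolation E p)"
proof (cases "A \<subseteq> H")
  case True
  have "{\<omega> \<in> space (percolation E p). {e \<in> H. \<omega> e} = A} =
      {\<omega> \<in> space (percolation E p). \<forall>e\<in>H. \<omega> e = (e \<in> A)}"
    using True by auto
  also have "\<dots> \<in> sets (percolation E p)"
    unfolding percolation_def
    by (intro sets.sets_Collect_finite_All assms sets_Collect_single') (use assms in auto)
  finally show ?thesis .
next
  case False
  then have "{\<omega> \<in> space (percolation E p). {e \<in> H. \<omega> e} = A} = {}" by auto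
  then show ?thesis by (metis sets.empty_sets)
qed

lemma measure_percolation_pattern:
  assumes "finite H" "H \<subseteq> E" "A \<subseteq> H" and p: "0 \<le> p" "p \<le> 1"
  shows "measure (percolation E p) {\<omega> \<in> space (percolation E p). {e \<in> H. \<omega> e} = A} =
    p ^ card A * (1 - p) ^ card (H - A)"
proof -
  let ?M = "\<lambda>_::'a set. measure_pmf (bernoulli_pmf p)"
  interpret product_prob_space ?M E
    by unfold_locales
  \<comment> \<open>A cylinder over \<open>H\<close>: its factor at \<open>e\<close> is the
    singleton containing the truth value of \<open>e \<in> A\<close>.\<close>
  have "{\<omega> \<in> space (percolation E p). {e \<in> H. \<omega> e} = A} =
      prod_emb E ?M H (PiE H (\<lambda>e. {e \<in> A}))"
    using assms(2,3) by (auto simp: prod_emb_def space_percolation PiE_iff restrict_def extensional_def)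
  then have "measure (percolation E p) {\<omega> \<in> space (percolation E p). {e \<in> H. \<omega> e} = A} =
      (\<Prod>e\<in>H. pmf (bernoulli_pmf p) (e \<in> A))"
    unfolding percolation_def using assms(1,2) by (simp add: measure_PiM_emb measure_pmf_single)
  also have "\<dots> = (\<Prod>e\<in>A. pmf (bernoulli_pmf p) (e \<in> A)) * (\<Prod>e\<in>H - A. pmf (bernoulli_pmf p) (e \<in> A))"
    using assms(1,3) by (metis mult.commute prod.subset_diff)
  also have "\<dots> = p ^ card A * (1 - p) ^ card (H - A)"
    using p by simp
  finally show ?thesis .
qed

text \<open>The finitely many edges meeting \<open>W\<close> decide the event, so it is a finite
  disjoint union of cylinders, one for each set \<open>A\<close> of occupied edges that joins
  \<open>v\<close> to exactly \<open>W\<close>.\<close>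

lemma
  assumes "finite {e \<in> E. e \<inter> W \<noteq> {}}"
  shows sets_cluster_eq:
      "{\<omega> \<in> space (percolation E p). cluster E \<omega> v = W} \<in> sets (percolation E p)"
    and measure_cluster_eq: "0 \<le> p \<Longrightarrow> p \<le> 1 \<Longrightarrow>
      measure (percolation E p) {\<omega> \<in> space (percolation E p). cluster E \<omega> v = W} =
      reach_poly {e \<in> E. e \<inter> W \<noteq> {}} {v} W p"
proof -
  define H where "H = {e \<in> E. e \<inter> W \<noteq> {}}"
  have H: "finite H" "H \<subseteq> E" using assms by (auto simp: H_def)
  define \<A> where "\<A> = {A \<in> Pow H. reach A {v} = W}"
  let ?P = "\<lambda>A. {\<omega> \<in> space (percolation E p). {e \<in> H. \<omega> e} = A}"
  have "cluster E \<omega> v = W \<longleftrightarrow> reach {e \<in> H. \<omega> e} {v} = W" for \<omega>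
  proof -
    have "{e \<in> {e \<in> E. \<omega> e}. e \<inter> W \<noteq> {}} = {e \<in> H. \<omega> e}" by (auto simp: H_def)
    then show ?thesis
      unfolding cluster_def by (subst component_restrict) (simp add: component_eq_reach)
  qed
  then have eq: "{\<omega> \<in> space (percolation E p). cluster E \<omega> v = W} = (\<Union>A\<in>\<A>. ?P A)"
    by (auto simp: \<A>_def)
  have fin: "finite \<A>" using H by (simp add: \<A>_def)
  show "{\<omega> \<in> space (percolation E p). cluster E \<omega> v = W} \<in> sets (percolation E p)"
    unfolding eq by (intro sets.finite_UN fin sets_percolation_pattern H)
  interpret prob_space "percolation E p" by (rule prob_space_percolation)
  assume p: "0 \<le> p" "p \<le> 1"
  have "measure (percolation E p) (\<Union>A\<in>\<A>. ?P A) = (\<Sum>A\<in>\<A>. measure (percolation E p) (?P A))"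
    by (intro finite_measure_finite_Union fin)
       (use sets_percolation_pattern[OF H] in \<open>auto simp: disjoint_family_on_def\<close>)
  also have "\<dots> = (\<Sum>A\<in>\<A>. p ^ card A * (1 - p) ^ card (H - A))"
    by (intro sum.cong refl measure_percolation_pattern H p) (auto simp: \<A>_def)
  also have "\<dots> = reach_poly H {v} W p"
    unfolding reach_poly_def \<A>_def using H(1) by (intro sum.mono_neutral_cong_left) auto
  finally show "measure (percolation E p) {\<omega> \<in> space (percolation E p). cluster E \<omega> v = W} =
      reach_poly {e \<in> E. e \<inter> W \<noteq> {}} {v} W p"
    by (simp add: eq H_def)
qed

section \<open>Isoperimetry and domination of the cluster polynomials\<close>

text \<open>Among the subgraphs on \<open>W\<close>, the induced one has the smallest boundary,
  namely the edges with exactly one end in \<open>W\<close>; it is the one compared with the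
  infimum.\<close>

lemma edge_cheeger_mult_card_le:
  assumes "graph V E" "W \<subseteq> V" "finite W"
  shows "edge_cheeger V E * card W \<le> card {e \<in> E. e \<inter> W \<noteq> {} \<and> \<not> e \<subseteq> W}"
proof (cases "W = {}")
  case False
  have *: "edge_boundary E W {e \<in> E. e \<subseteq> W} = {e \<in> E. e \<inter> W \<noteq> {} \<and> \<not> e \<subseteq> W}"
    by (auto simp: edge_boundary_def)
  have "subgraph W {e \<in> E. e \<subseteq> W} V E"
    using assms by (auto simp: subgraph_def graph_def)
  then have "edge_cheeger V E \<le> real (card (edge_boundary E W {e \<in> E. e \<subseteq> W})) / real (card W)"
    unfolding edge_cheeger_def
    using False assms by (intro cInf_lower bdd_belowI[of _ 0]) auto
  then show ?thesis
    using False assms by (simp add: * field_simps card_gt_0_iff)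
qed auto

text \<open>At least \<open>h\<close> boundary edges are available per vertex gained, so it would
  suffice that \<open>s\<close> times the \<open>h\<close>-th power of \<open>t\<close> is at most
  1. The linear condition on \<open>s\<close> and \<open>t\<close> implies this through
  \<open>1 + x \<le> exp x\<close> and avoids real exponents.\<close>

lemma norm_cluster_poly_le:
  fixes z :: complex and q s t :: real
  assumes "graph V E" "W \<subseteq> V" "finite W" "finite {e \<in> E. e \<inter> W \<noteq> {}}"
    and st: "0 \<le> s" "0 \<le> t" "norm z \<le> s * q" "norm (1 - z) \<le> t * (1 - q)" "t \<le> 1"
    and q: "0 \<le> q" "q \<le> 1"
    and h: "0 \<le> edge_cheeger V E" "s - 1 + edge_cheeger V E * (t - 1) \<le> 0"
  shows "norm (reach_poly {e \<in> E. e \<inter> W \<noteq> {}} {v} W z) \<le>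
    reach_poly {e \<in> E. e \<inter> W \<noteq> {}} {v} W q"
proof -
  let ?H = "{e \<in> E. e \<inter> W \<noteq> {}}" and ?h = "edge_cheeger V E"
  let ?m = "card (W - {v})" and ?b = "card {e \<in> ?H. e \<inter> W \<noteq> {} \<and> \<not> e \<subseteq> W}"
  have "?h * ?m \<le> ?h * card W"
    using h(1) \<open>finite W\<close> by (intro mult_left_mono) (auto intro!: card_mono)
  also have "\<dots> \<le> ?b"
    using edge_cheeger_mult_card_le[OF assms(1-3)] by (simp add: conj_ac cong: conj_cong)
  finally have b: "?h * ?m \<le> ?b" .
  have "s ^ ?m * t ^ ?b \<le> exp (s - 1) ^ ?m * exp (t - 1) ^ ?b"
    using st exp_ge_add_one_self[of "s - 1"] exp_ge_add_one_self[of "t - 1"]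
    by (intro mult_mono power_mono) auto
  also have "\<dots> = exp (?m * (s - 1) + ?b * (t - 1))"
    by (simp add: exp_add exp_of_nat_mult)
  also have "\<dots> \<le> 1"
  proof -
    have "?b * (t - 1) \<le> ?h * ?m * (t - 1)"
      using b st by (intro mult_right_mono_neg) auto
    then have "?m * (s - 1) + ?b * (t - 1) \<le> ?m * (s - 1 + ?h * (t - 1))"
      by (simp add: algebra_simps)
    also have "\<dots> \<le> 0" using h(2) by (simp add: mult_nonneg_nonpos)
    finally show ?thesis by simp
  qed
  finally have *: "s ^ ?m * t ^ ?b \<le> 1" .
  have "norm (reach_poly ?H {v} W z) \<le> s ^ ?m * t ^ ?b * reach_poly ?H {v} W q"
    by (rule norm_reach_poly_le) (use assms in \<open>auto simp: graph_def\<close>)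
  also have "\<dots> \<le> reach_poly ?H {v} W q"
    using mult_right_mono[OF * reach_poly_nonneg[OF q]] by simp
  finally show ?thesis .
qed

section \<open>Summation over finite clusters\<close>

lemma finite_incident_edges:
  assumes "bounded_degree V E" "W \<subseteq> V" "finite W"
  shows "finite {e \<in> E. e \<inter> W \<noteq> {}}"
proof -
  have "{e \<in> E. e \<inter> W \<noteq> {}} = (\<Union>x\<in>W. {e \<in> E. x \<in> e})" by auto
  then show ?thesis using assms by (auto simp: bounded_degree_def)
qed

text \<open>All vertices are reached from one by iterating the neighbourhood relation, which
  preserves countability. This allows the finite vertex sets to be enumerated.\<close>

lemma countable_vertices:
  assumes "graph V E" "bounded_degree V E" "connected_graph V E"
  shows "countable V"
proof (cases "V = {}")
  case False
  then obtain x where x: "x \<in> V" by blast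
  let ?r = "{(x, y). {x, y} \<in> E}"
  have "countable (?r `` X)" if "countable X" for X
  proof -
    have "countable (?r `` {y})" for y
    proof (cases "y \<in> V")
      case True
      have "finite e" if "e \<in> E" for e
        using assms(1) that by (auto simp: graph_def intro: card_ge_0_finite)
      then have "finite (\<Union>{e \<in> E. y \<in> e})"
        using assms(2) True by (auto simp: bounded_degree_def)
      moreover have "?r `` {y} \<subseteq> \<Union>{e \<in> E. y \<in> e}" by auto
      ultimately show ?thesis by (blast intro: countable_finite finite_subset)
    next
      case False
      then have "?r `` {y} = {}" using assms(1) by (auto simp: graph_def)
      then show ?thesis by simp
    qed
    moreover have "?r `` X = (\<Union>y\<in>X. ?r `` {y})" by auto
    ultimately show ?thesis using that by (metis countable_UN)
  qed
  then have "countable (?r\<^sup>* `` {x})"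
    by (intro countable_rtrancl) auto
  moreover have "V \<subseteq> ?r\<^sup>* `` {x}"
    using x assms(3) by (auto simp: connected_graph_def component_def)
  ultimately show ?thesis by (rule countable_subset[rotated])
qed simp

lemma cluster_subset:
  assumes "graph V E" "v \<in> V"
  shows "cluster E \<omega> v \<subseteq> V"
  unfolding cluster_def component_eq_reach
  using assms by (intro reach_subsetI) (auto simp: graph_def)

text \<open>Countable additivity: the events that the cluster is \<open>S i\<close> are disjoint and
  exhaust the event that it is finite. Sets \<open>S i\<close> without \<open>v\<close> merely
  contribute zero terms.\<close>

lemma finite_cluster_sums:
  assumes "graph V E" "bounded_degree V E" "v \<in> V" "0 \<le> p" "p \<le> 1"
    and S: "bij_betw S UNIV {W. W \<subseteq> V \<and> finite W}"
  shows "(\<lambda>i. reach_poly {e \<in> E. e \<inter> S i \<noteq> {}} {v} (S i) p) sums (1 - perc_prob E v p)"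
proof -
  interpret prob_space "percolation E p" by (rule prob_space_percolation)
  let ?A = "\<lambda>i. {\<omega> \<in> space (percolation E p). cluster E \<omega> v = S i}"
  have Si: "S i \<subseteq> V" "finite (S i)" for i
    using bij_betwE[OF S] by auto
  note fin = finite_incident_edges[OF assms(2) Si]
  have "disjoint_family ?A"
    using bij_betw_imp_inj_on[OF S] by (auto simp: disjoint_family_on_def inj_on_def)
  then have "(\<lambda>i. measure (percolation E p) (?A i)) sums measure (percolation E p) (\<Union>i. ?A i)"
    using sets_cluster_eq[OF fin] by (intro finite_measure_UNION) auto
  moreover have UN: "(\<Union>i. ?A i) = {\<omega> \<in> space (percolation E p). finite (cluster E \<omega> v)}"
  proof -
    have "cluster E \<omega> v \<in> range S \<longleftrightarrow> finite (cluster E \<omega> v)" for \<omega>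
      using cluster_subset[OF assms(1,3)] unfolding bij_betw_imp_surj_on[OF S] by simp
    then show ?thesis by (auto simp: image_iff)
  qed
  moreover have "measure (percolation E p) {\<omega> \<in> space (percolation E p). finite (cluster E \<omega> v)} =
      1 - perc_prob E v p"
  proof -
    have "{\<omega> \<in> space (percolation E p). infinite (cluster E \<omega> v)} =
        space (percolation E p) - (\<Union>i. ?A i)"
      unfolding UN by auto
    moreover have "(\<Union>i. ?A i) \<in> sets (percolation E p)"
      by (intro sets.countable_UN image_subsetI sets_cluster_eq fin)
    ultimately show ?thesis
      unfolding perc_prob_def UN[symmetric] by (simp add: prob_compl)
  qed
  ultimately show ?thesis
    using measure_cluster_eq[OF fin assms(4,5)] by simp
qed

section \<open>Analyticity above the threshold\<close>

lemma holomorphic_reach_poly: "reach_poly H R W holomorphic_on A"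
  unfolding reach_poly_def by (intro holomorphic_intros)

lemma perc_prob_locally_holomorphic:
  assumes G: "graph V E" "infinite V" "connected_graph V E" "bounded_degree V E" "v \<in> V"
    and h: "edge_cheeger V E > 0"
    and x: "1 / (1 + edge_cheeger V E) < x" "x \<le> 1"
  shows "\<exists>r>0. \<exists>g. g holomorphic_on ball (complex_of_real x) r \<and>
    (\<forall>y\<in>{0..1}. complex_of_real y \<in> ball (complex_of_real x) r \<longrightarrow>
      g (complex_of_real y) = complex_of_real (perc_prob E v y))"
proof -
  define h where "h = edge_cheeger V E"
  note h = h[folded h_def] and x = x[folded h_def]
  have pos: "0 < 1 / (1 + h)" using h by simp
  obtain q where q: "1 / (1 + h) < q" "q < x" using dense[OF x(1)] by blast
  have q01: "0 < q" "q < 1" using order.strict_trans[OF pos q(1)] q(2) x(2) by simp_all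
  \<comment> \<open>Equivalently, the logarithmic derivative \<open>1/q - h/(1 - q)\<close> of
    \<open>q (1 - q)^h\<close> is negative. This is what makes the radius \<open>r\<close>
    positive.\<close>
  have hq: "1 - q < h * q" using q(1) h by (simp add: field_simps)
  define c where "c = h * q + 1 - q"
  have c: "0 < c" using q01 hq by (simp add: c_def)
  define r where "r = (x - q) * (h * q - (1 - q)) / c"
  have r: "0 < r" using c q hq by (simp add: r_def)
  \<comment> \<open>On the disc, \<open>norm z\<close> is at most \<open>x + r\<close> and
    \<open>norm (1 - z)\<close> at most \<open>1 - x + r\<close>; \<open>s\<close> and
    \<open>t\<close> compare these bounds with \<open>q\<close> and \<open>1 - q\<close>.\<close>
  define s where "s = (x + r) / q"
  define t where "t = (1 - x + r) / (1 - q)"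
  text \<open>The radius is chosen so that \<open>s - 1 + h (t - 1) = 0\<close>.\<close>
  have s1: "s - 1 = 2 * h * (x - q) / c"
    using q01 c by (simp add: s_def r_def field_simps) (simp add: c_def algebra_simps)
  have t1: "t - 1 = - 2 * (x - q) / c"
    using q01 c by (simp add: t_def r_def field_simps) (simp add: c_def algebra_simps)
  have "0 \<le> s" "0 \<le> t" using r q01 q x by (simp_all add: s_def t_def)
  have "t - 1 \<le> 0" using c q unfolding t1 by (simp add: divide_nonpos_pos)
  then have "t \<le> 1" by simp
  have st: "s - 1 + h * (t - 1) \<le> 0"
    unfolding s1 t1 by (simp add: divide_simps) (simp add: algebra_simps)

  let ?\<W> = "{W. W \<subseteq> V \<and> finite W}"
  have "countable ?\<W>"
    using countable_Collect_finite_subset[OF countable_vertices[OF G(1,4,3)]]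
    by (simp add: conj_commute)
  \<comment> \<open>Infinitude lets \<open>from_nat_into\<close> enumerate the finite sets
    bijectively by all natural numbers.\<close>
  moreover have "infinite ?\<W>"
  proof -
    have "(\<lambda>x. {x}) ` V \<subseteq> ?\<W>" by auto
    moreover have "infinite ((\<lambda>x. {x}) ` V)"
      using G(2) by (simp add: finite_image_iff)
    ultimately show ?thesis using finite_subset by blast
  qed
  ultimately have S: "bij_betw (from_nat_into ?\<W>) UNIV ?\<W>"
    by (rule bij_betw_from_nat_into)
  define S where "S = from_nat_into ?\<W>"
  note S = S[folded S_def]
  define P :: "nat \<Rightarrow> complex \<Rightarrow> complex"
    where "P i = reach_poly {e \<in> E. e \<inter> S i \<noteq> {}} {v} (S i)" for i
  define M where "M i = reach_poly {e \<in> E. e \<inter> S i \<noteq> {}} {v} (S i) q" for i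
  note sums = finite_cluster_sums[OF G(1,4,5) _ _ S]
  have "summable M"
    using sums[of q] q01 by (auto simp: M_def[abs_def] sums_iff)
  have bound: "norm (P i z) \<le> M i" if "z \<in> ball (complex_of_real x) r" for i z
  proof -
    have d: "norm (z - of_real x) \<le> r"
      using that by (simp add: dist_norm norm_minus_commute)
    have "norm z \<le> norm (complex_of_real x) + norm (z - of_real x)"
      using norm_triangle_ineq[of "complex_of_real x" "z - of_real x"] by simp
    then have z1: "norm z \<le> s * q"
      using d q q01 by (simp add: s_def)
    have "norm (1 - z) \<le> norm (complex_of_real (1 - x)) + norm (z - of_real x)"
      using norm_triangle_ineq4[of "complex_of_real (1 - x)" "z - of_real x"] by simp
    also have "norm (complex_of_real (1 - x)) = 1 - x"
      using x by (simp only: norm_of_real)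
    finally have z2: "norm (1 - z) \<le> t * (1 - q)"
      using d q01 by (simp add: t_def)
    have Si: "S i \<subseteq> V" "finite (S i)"
      using bij_betwE[OF S] by auto
    show ?thesis
      unfolding P_def M_def
      by (rule norm_cluster_poly_le[OF G(1) Si finite_incident_edges[OF G(4) Si] _ _ z1 z2])
         (use \<open>0 \<le> s\<close> \<open>0 \<le> t\<close> \<open>t \<le> 1\<close> q01 h st in \<open>auto simp: h_def\<close>)
  qed
  have lim: "uniform_limit (ball (complex_of_real x) r)
      (\<lambda>n z. \<Sum>i<n. P i z) (\<lambda>z. \<Sum>i. P i z) sequentially"
    using bound \<open>summable M\<close> by (rule Weierstrass_m_test)
  have "(\<lambda>z. \<Sum>i. P i z) holomorphic_on ball (complex_of_real x) r"
  proof (rule holomorphic_uniform_sequence[OF open_ball])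
    show "(\<lambda>z. \<Sum>i<n. P i z) holomorphic_on ball (complex_of_real x) r" for n
      unfolding P_def by (intro holomorphic_intros holomorphic_reach_poly)
    fix z assume "z \<in> ball (complex_of_real x) r"
    then obtain d where "0 < d" "cball z d \<subseteq> ball (complex_of_real x) r"
      using open_contains_cball by blast
    then show "\<exists>d>0. cball z d \<subseteq> ball (complex_of_real x) r \<and>
        uniform_limit (cball z d) (\<lambda>n z. \<Sum>i<n. P i z) (\<lambda>z. \<Sum>i. P i z) sequentially"
      using lim uniform_limit_on_subset by blast
  qed
  then have "(\<lambda>z. 1 - (\<Sum>i. P i z)) holomorphic_on ball (complex_of_real x) r"
    by (intro holomorphic_intros)
  moreover have "1 - (\<Sum>i. P i (complex_of_real y)) = complex_of_real (perc_prob E v y)"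
    if "y \<in> {0..1}" for y
  proof -
    have "(\<lambda>i. P i (complex_of_real y)) sums complex_of_real (1 - perc_prob E v y)"
      using sums_of_real[OF sums[of y], where 'a=complex] that
      by (simp add: P_def of_real_reach_poly)
    then show ?thesis by (simp add: sums_iff)
  qed
  ultimately show ?thesis using r by blast
qed

theorem theorem5p1:
  fixes V :: "'a set" and E :: "'a set set" and v :: 'a
  assumes "graph V E"
    and "infinite V"
    and "connected_graph V E"
    and "bounded_degree V E"
    and "edge_cheeger V E > 0"
    and "v \<in> V"
  shows "p_analytic E v \<le> 1 / (1 + edge_cheeger V E)"
proof -
  let ?p = "1 / (1 + edge_cheeger V E)"
  have p: "0 \<le> ?p" "?p \<le> 1" using assms(5) by auto
  have "analytic_on_interval (perc_prob E v) {?p<..1}"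
    unfolding analytic_on_interval_def
  proof
    fix x assume "x \<in> {?p<..1}"
    then obtain r g where "r > 0" "g holomorphic_on ball (complex_of_real x) r"
      "\<forall>y\<in>{0..1}. complex_of_real y \<in> ball (complex_of_real x) r \<longrightarrow>
        g (complex_of_real y) = complex_of_real (perc_prob E v y)"
      using perc_prob_locally_holomorphic[OF assms(1-4,6,5), of x] by auto
    moreover have "{?p<..1} \<subseteq> {0..1}"
      using p(1) by (meson atLeastAtMost_iff greaterThanAtMost_iff less_imp_le order_trans subsetI)
    ultimately show "\<exists>r>0. \<exists>g. g holomorphic_on ball (complex_of_real x) r \<and>
        (\<forall>y\<in>{?p<..1}. complex_of_real y \<in> ball (complex_of_real x) r \<longrightarrow>
           g (complex_of_real y) = complex_of_real (perc_prob E v y))"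
      by blast
  qed
  \<comment> \<open>The threshold itself belongs to the set whose infimum is
    \<open>p_analytic\<close>, because the interval of analyticity is open on the left.\<close>
  then show ?thesis
    unfolding p_analytic_def using p by (intro cInf_lower bdd_belowI[of _ 0]) auto
qed

end
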